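(* Every binary linear code $\mathcal{C}\subseteq GF(2)^n$ has a geometric representation embeddable into $\mathbb{R}^4$.
   Context: A binary linear code of length $n$ is a linear subspace $\mathcal{C}\subseteq GF(2)^n$. A triangular configuration is a finite two-dimensional simplicial complex (finite set of geometric simplices closed under faces, any two intersecting in a common face or not at all) in which every maximal simplex is a triangle or a segment; $T(\Delta)$ is its set of triangles. Its incidence matrix over $GF(2)$ has rows indexed by edges and columns by triangles, entry $1$ iff the edge is a side of the triangle; $\ker\Delta\subseteq GF(2)^{T(\Delta)}$ is the kernel. Puncturing a code along a set $S$ of coordinates deletes the entries indexed by $S$; the result is $\mathcal{D}/S$. $\mathcal{C}$ has a geometric representation if there is a triangular configuration $\Delta$ and $S\subseteq T(\Delta)$ such that, after identifying $T(\Delta)\setminus S$ with $\{1,\dots,n\}$ by a suitable bijection, $\mathcal{C}=\ker\Delta/S$ and $\dim\mathcal{C}=\dim\ker\Delta$; it is embeddable into $\mathbb{R}^k$ if $\Delta$ is isomorphic to a triangular configuration whose simplices lie in $\mathbb{R}^k$. *)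

theory Defs
  imports "HOL-Analysis.Analysis" "HOL-Library.Z2" "HOL-Library.Function_Algebras"
begin

text \<open>
  The space \<open>GF(2)\<^sup>X\<close> for a finite set \<open>X\<close> is represented by the functions into \<^typ>\<open>bit\<close> that
  vanish outside \<open>X\<close>.  This covers both words of length \<open>n\<close> (\<open>X = {1..n}\<close>) and
  vectors indexed by the triangles of a configuration.
\<close>

definition scale_bit :: "bit \<Rightarrow> ('x \<Rightarrow> bit) \<Rightarrow> 'x \<Rightarrow> bit" where
  "scale_bit c v = (\<lambda>x. c * v x)"

interpretation GF2: vector_space "scale_bit :: bit \<Rightarrow> ('x \<Rightarrow> bit) \<Rightarrow> 'x \<Rightarrow> bit"
  by unfold_locales (auto simp: scale_bit_def fun_eq_iff plus_fun_def algebra_simps)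

definition GF2_space :: "'x set \<Rightarrow> ('x \<Rightarrow> bit) set" where
  "GF2_space X = {v. \<forall>x. x \<notin> X \<longrightarrow> v x = 0}"

definition binary_linear_code :: "nat \<Rightarrow> (nat \<Rightarrow> bit) set \<Rightarrow> bool" where
  "binary_linear_code n \<C> \<longleftrightarrow> \<C> \<subseteq> GF2_space {1..n} \<and> GF2.subspace \<C>"

text \<open>Deleted coordinates are set to 0, so the result lives in \<open>GF(2)\<^sup>X\<^sup>-\<^sup>S\<close>.\<close>

definition puncture :: "('x \<Rightarrow> bit) set \<Rightarrow> 'x set \<Rightarrow> ('x \<Rightarrow> bit) set" where
  "puncture \<D> S = (\<lambda>v x. if x \<in> S then 0 else v x) ` \<D>"

definition relabel :: "'i set \<Rightarrow> ('i \<Rightarrow> 'x) \<Rightarrow> ('x \<Rightarrow> bit) set \<Rightarrow> ('i \<Rightarrow> bit) set" where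
  "relabel I b \<D> = (\<lambda>v i. if i \<in> I then v (b i) else 0) ` \<D>"

text \<open>
  Simplices are point sets, and \<^const>\<open>simplicial_complex\<close> counts the empty set as a
  simplex of dimension \<open>-1\<close>, so two disjoint simplices meet in an (empty) common face.
  The existence of a triangle makes the complex two-dimensional; that no simplex has
  dimension above 2 follows from the condition on maximal simplices.
\<close>

definition triangular_configuration :: "'a::euclidean_space set set \<Rightarrow> bool" where
  "triangular_configuration \<Delta> \<longleftrightarrow>
     simplicial_complex \<Delta> \<and>
     (\<exists>\<sigma>\<in>\<Delta>. 2 simplex \<sigma>) \<and>
     (\<forall>\<sigma>\<in>\<Delta>. (\<forall>\<tau>\<in>\<Delta>. \<sigma> \<subseteq> \<tau> \<longrightarrow> \<tau> = \<sigma>) \<longrightarrow> 2 simplex \<sigma> \<or> 1 simplex \<sigma>)"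

definition triangles :: "'a::euclidean_space set set \<Rightarrow> 'a set set" where
  "triangles \<Delta> = {t \<in> \<Delta>. 2 simplex t}"

definition edges :: "'a::euclidean_space set set \<Rightarrow> 'a set set" where
  "edges \<Delta> = {e \<in> \<Delta>. 1 simplex e}"

definition incidence :: "'a::euclidean_space set \<Rightarrow> 'a set \<Rightarrow> bit" where
  "incidence e t = (if e face_of t then 1 else 0)"

definition config_ker :: "'a::euclidean_space set set \<Rightarrow> ('a set \<Rightarrow> bit) set" where
  "config_ker \<Delta> = {v \<in> GF2_space (triangles \<Delta>).
     \<forall>e\<in>edges \<Delta>. (\<Sum>t\<in>triangles \<Delta>. incidence e t * v t) = 0}"

definition geometric_representation ::
    "nat \<Rightarrow> (nat \<Rightarrow> bit) set \<Rightarrow> 'a::euclidean_space set set \<Rightarrow> 'a set set \<Rightarrow> bool" where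
  "geometric_representation n \<C> \<Delta> S \<longleftrightarrow>
     triangular_configuration \<Delta> \<and> S \<subseteq> triangles \<Delta> \<and>
     (\<exists>b. bij_betw b {1..n} (triangles \<Delta> - S) \<and>
          \<C> = relabel {1..n} b (puncture (config_ker \<Delta>) S)) \<and>
     GF2.dim \<C> = GF2.dim (config_ker \<Delta>)"

definition vertex_scheme :: "'a::euclidean_space set set \<Rightarrow> 'a set set" where
  "vertex_scheme \<Delta> = (\<lambda>\<sigma>. {x. x extreme_point_of \<sigma>}) ` \<Delta>"

definition config_isomorphic ::
    "'a::euclidean_space set set \<Rightarrow> 'b::euclidean_space set set \<Rightarrow> bool" where
  "config_isomorphic \<Delta> \<Delta>' \<longleftrightarrow>
     (\<exists>f. bij_betw f (\<Union> (vertex_scheme \<Delta>)) (\<Union> (vertex_scheme \<Delta>')) \<and>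
          (`) f ` vertex_scheme \<Delta> = vertex_scheme \<Delta>')"

definition embeddable_into ::
    "'a::euclidean_space set set \<Rightarrow> 'b::euclidean_space itself \<Rightarrow> bool" where
  "embeddable_into \<Delta> (_ :: 'b itself) \<longleftrightarrow>
     (\<exists>\<Delta>' :: 'b set set. triangular_configuration \<Delta>' \<and> config_isomorphic \<Delta> \<Delta>')"

end

theory Submission
  imports Defs
begin

text \<open>
  Write \<open>\<C>\<close> as the kernel of a parity check matrix.  Every coordinate is represented by a connected
  sheet of triangles, and every check by an edge at which exactly the sheets of its coordinates
  meet.  All other boundary edges of the sheets are coned off from one extra vertex.  A cycle is then
  constant on every sheet, the cycle conditions at the check edges are the parity checks, and the
  values on the cone are determined, so restriction to one triangle per sheet is an
  isomorphism from the kernel onto \<open>\<C>\<close>.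

  The vertices can be numbered such that every triangle has the form \<open>{0, p, q}\<close> or \<open>{p, p + 1, q}\<close>.
  Put vertex \<open>m\<close> at the point \<open>(m, m\<^sup>2, m\<^sup>3, m\<^sup>4)\<close> of the moment curve in \<open>\<real>\<^sup>4\<close>.  The polynomials
  \<open>x (x - p)\<^sup>2 (x - q)\<^sup>2\<close> and \<open>(x + 1) (x - p) (x - p - 1) (x - q)\<^sup>2\<close> are nonnegative on the vertices and
  vanish exactly on the triangle, and they differ from \<open>x\<^sup>5\<close> by an affine function of the point.  Hence
  the triangles are faces of the lower hull of the points lifted to height \<open>m\<^sup>5\<close>, and no two of
  them intersect improperly.
\<close>

subsection \<open>Regular complexes on the moment curve\<close>

text \<open>
  The faces of the lower convex hull of a point configuration \<open>P\<close> lifted to the heights \<open>h\<close>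
  project to a simplicial complex (a regular subdivision).
\<close>

locale lifted_complex =
  fixes P :: "'a::euclidean_space set" and h :: "'a \<Rightarrow> real" and K :: "'a set set"
  assumes finite_points: "finite P"
    and subset_points: "s \<in> K \<Longrightarrow> s \<subseteq> P"
    and down_closed: "s \<in> K \<Longrightarrow> r \<subseteq> s \<Longrightarrow> r \<in> K"
    and support: "s \<in> K \<Longrightarrow> \<exists>c d. \<forall>x\<in>P. c \<bullet> x + d \<le> h x \<and> (h x = c \<bullet> x + d \<longleftrightarrow> x \<in> s)"
begin

text \<open>Extending the weights by zero to all of \<open>P\<close> lets two representations of one
  point be compared over a common index set.\<close>

lemma hull_weights:
  assumes "s \<in> K" "y \<in> convex hull s"
  obtains u where "\<And>x. 0 \<le> u x" "\<And>x. x \<notin> s \<Longrightarrow> u x = 0" "sum u P = 1" "(\<Sum>x\<in>P. u x *\<^sub>R x) = y"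
proof -
  have s: "s \<subseteq> P" "finite s"
    using subset_points[OF assms(1)] finite_points finite_subset by auto
  obtain u where u: "\<forall>x\<in>s. 0 \<le> u x" "sum u s = 1" "(\<Sum>x\<in>s. u x *\<^sub>R x) = y"
    using assms(2) unfolding convex_hull_finite[OF s(2)] by auto
  let ?u = "\<lambda>x. if x \<in> s then u x else 0"
  have "sum ?u P = sum u s"
    using s finite_points by (intro sum.mono_neutral_cong_right) auto
  moreover have "(\<Sum>x\<in>P. ?u x *\<^sub>R x) = (\<Sum>x\<in>s. u x *\<^sub>R x)"
    using s finite_points by (intro sum.mono_neutral_cong_right) auto
  ultimately show thesis
    using u by (intro that[of ?u]) auto
qed

text \<open>For fixed \<open>y\<close> the averaged gap depends on the weights only through the mean
  height.\<close>

lemma weighted_gap: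
  assumes "sum u P = 1" "(\<Sum>x\<in>P. u x *\<^sub>R x) = y"
  shows "(\<Sum>x\<in>P. u x * (h x - (c \<bullet> x + d))) = (\<Sum>x\<in>P. u x * h x) - (c \<bullet> y + d)"
proof -
  have "(\<Sum>x\<in>P. u x * (h x - (c \<bullet> x + d)))
      = (\<Sum>x\<in>P. u x * h x) - (c \<bullet> (\<Sum>x\<in>P. u x *\<^sub>R x) + sum u P * d)"
    by (simp add: inner_sum_right sum_distrib_right sum_distrib_left sum_subtractf sum.distrib algebra_simps)
  then show ?thesis
    using assms by simp
qed

text \<open>Weights supported on a member of \<open>K\<close> attain the least mean height among all
  representations of \<open>y\<close>. Weights \<open>w\<close> on \<open>r\<close> therefore have
  zero mean gap for the support of \<open>s\<close> too, which forces them onto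
  \<open>s \<inter> r\<close>.\<close>

lemma convex_hull_Int:
  assumes s: "s \<in> K" and r: "r \<in> K"
  shows "convex hull s \<inter> convex hull r = convex hull (s \<inter> r)"
proof (intro equalityI subsetI)
  fix y assume y: "y \<in> convex hull s \<inter> convex hull r"
  obtain u where
    u: "\<And>x. 0 \<le> u x" "\<And>x. x \<notin> s \<Longrightarrow> u x = 0" "sum u P = 1" "(\<Sum>x\<in>P. u x *\<^sub>R x) = y"
    using hull_weights[OF s] y by blast
  obtain w where
    w: "\<And>x. 0 \<le> w x" "\<And>x. x \<notin> r \<Longrightarrow> w x = 0" "sum w P = 1" "(\<Sum>x\<in>P. w x *\<^sub>R x) = y"
    using hull_weights[OF r] y by blast
  obtain c d where c: "\<And>x. x \<in> P \<Longrightarrow> c \<bullet> x + d \<le> h x" "\<And>x. x \<in> P \<Longrightarrow> h x = c \<bullet> x + d \<longleftrightarrow> x \<in> s"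
    using support[OF s] by blast
  obtain c' d' where c': "\<And>x. x \<in> P \<Longrightarrow> c' \<bullet> x + d' \<le> h x" "\<And>x. x \<in> P \<Longrightarrow> h x = c' \<bullet> x + d' \<longleftrightarrow> x \<in> r"
    using support[OF r] by blast
  have "(\<Sum>x\<in>P. u x * (h x - (c \<bullet> x + d))) = 0"
    using u(2) c(2) by (intro sum.neutral) auto
  moreover have "(\<Sum>x\<in>P. w x * (h x - (c' \<bullet> x + d'))) = 0"
    using w(2) c'(2) by (intro sum.neutral) auto
  moreover have "(\<Sum>x\<in>P. u x * (h x - (c' \<bullet> x + d'))) \<ge> 0"
    using u(1) c'(1) by (intro sum_nonneg) auto
  moreover have nonneg: "0 \<le> w x * (h x - (c \<bullet> x + d))" if "x \<in> P" for x
    using w(1) c(1) that by auto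
  then have "(\<Sum>x\<in>P. w x * (h x - (c \<bullet> x + d))) \<ge> 0"
    by (intro sum_nonneg) auto
  \<comment> \<open>The mean height of \<open>w\<close> is \<open>c' \<bullet> y + d'\<close>, at
    most that of \<open>u\<close>, which is \<open>c \<bullet> y + d\<close>, at most that of
    \<open>w\<close>. Hence equality throughout.\<close>
  ultimately have "(\<Sum>x\<in>P. w x * (h x - (c \<bullet> x + d))) = 0"
    unfolding weighted_gap[OF u(3,4)] weighted_gap[OF w(3,4)] by linarith
  then have "\<And>x. x \<in> P \<Longrightarrow> w x * (h x - (c \<bullet> x + d)) = 0"
    using nonneg finite_points by (simp add: sum_nonneg_eq_0_iff)
  then have w0: "w x = 0" if "x \<in> P" "x \<notin> s \<inter> r" for x
    using that c(2)[of x] w(2)[of x] by fastforce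
  have sub: "s \<inter> r \<subseteq> P"
    using subset_points s by blast
  have "sum w (s \<inter> r) = 1"
    unfolding w(3)[symmetric] using w0 sub finite_points by (intro sum.mono_neutral_left) auto
  moreover have "(\<Sum>x\<in>s \<inter> r. w x *\<^sub>R x) = y"
    unfolding w(4)[symmetric] using w0 sub finite_points by (intro sum.mono_neutral_left) auto
  ultimately show "y \<in> convex hull (s \<inter> r)"
    using w(1) finite_subset[OF sub finite_points] by (auto simp: convex_hull_finite)
qed (meson Int_iff hull_mono inf_le1 inf_le2 subsetD)

text \<open>By Radon a dependent \<open>s\<close> splits into disjoint parts with meeting hulls.
  Both parts lie in \<open>K\<close>, so their hulls meet only in the hull of the empty set.\<close>

lemma independent:
  assumes "s \<in> K" shows "\<not> affine_dependent s"
proof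
  assume "affine_dependent s"
  then obtain M Q where "M \<inter> Q = {}" "M \<union> Q = s" "convex hull M \<inter> convex hull Q \<noteq> {}"
    using Radon_partition finite_points subset_points[OF assms] finite_subset by metis
  then show False
    using convex_hull_Int[of M Q] down_closed[OF assms, of M] down_closed[OF assms, of Q] by auto
qed

lemma convex_hull_face_iff:
  assumes "s \<in> K" "r \<in> K"
  shows "convex hull r face_of convex hull s \<longleftrightarrow> r \<subseteq> s"
proof
  assume "convex hull r face_of convex hull s"
  then have eq: "convex hull r = convex hull (s \<inter> r)"
    using face_of_imp_subset convex_hull_Int[OF assms] by blast
  have "\<not> affine_dependent r" "\<not> affine_dependent (s \<inter> r)"
    using independent assms down_closed[of r "s \<inter> r"] by auto
  \<comment> \<open>An affinely independent set consists of the extreme points of its hull, so equal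
    hulls have equal vertex sets.\<close>
  then show "r \<subseteq> s"
    using extreme_point_of_convex_hull_affine_independent eq by (metis inf_le1 subset_iff)
next
  assume "r \<subseteq> s"
  then show "convex hull r face_of convex hull s"
    using face_of_convex_hull_affine_independent[OF independent[OF assms(1)]] by blast
qed

lemma simplex_hull_iff:
  assumes "s \<in> K" shows "k simplex (convex hull s) \<longleftrightarrow> int (card s) = k + 1"
proof -
  have "(int (card s) - 1) simplex (convex hull s)"
    using independent[OF assms] by (intro simplex_convex_hull) auto
  moreover from this have "k = int (card s) - 1" if "k simplex (convex hull s)"
    using that[THEN aff_dim_simplex] aff_dim_simplex by fastforce
  ultimately show ?thesis
    by auto
qed

lemma simplicial_complex_hulls: "simplicial_complex ((hull) convex ` K)"
  unfolding simplicial_complex_def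
proof (intro conjI ballI allI impI)
  have "K \<subseteq> Pow P"
    using subset_points by blast
  then show "finite ((hull) convex ` K)"
    using finite_points finite_subset by blast
next
  fix S assume "S \<in> (hull) convex ` K"
  then show "\<exists>n. n simplex S"
    using simplex_hull_iff[where k = "int (card s) - 1" for s] by fastforce
next
  fix F S assume *: "S \<in> (hull) convex ` K \<and> F face_of S"
  then obtain s where "s \<in> K" "S = convex hull s"
    by auto
  then obtain r where "r \<subseteq> s" "F = convex hull r"
    using * face_of_convex_hull_affine_independent[OF independent] by metis
  then show "F \<in> (hull) convex ` K"
    using down_closed \<open>s \<in> K\<close> by auto
next
  fix S S' assume "S \<in> (hull) convex ` K \<and> S' \<in> (hull) convex ` K"
  then obtain s s' where *: "s \<in> K" "s' \<in> K" "S = convex hull s" "S' = convex hull s'"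
    by auto
  then have "s \<inter> s' \<in> K"
    using down_closed by blast
  then show "S \<inter> S' face_of S"
    using * by (simp add: convex_hull_Int convex_hull_face_iff)
qed

end

section \<open>Quintic supports on the moment curve\<close>

definition vector4 :: "real \<Rightarrow> real \<Rightarrow> real \<Rightarrow> real \<Rightarrow> real^4" where
  "vector4 a b c d = (\<chi> i. if i = 1 then a else if i = 2 then b else if i = 3 then c else d)"

lemma inner_vector4: "vector4 a b c d \<bullet> vector4 a' b' c' d' = a * a' + b * b' + c * c' + d * d'"
  by (simp add: vector4_def inner_vec_def sum_4)

definition moment :: "real \<Rightarrow> real^4" where
  "moment x = vector4 x (x^2) (x^3) (x^4)"

lemma inj_moment: "inj moment"
  by (rule injI) (simp add: moment_def vector4_def vec_eq_iff forall_4)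

text \<open>Monomials of degree at most four are affine in the moment point, so every monic quintic
  is a gap for the height \<open>x^5\<close>.\<close>

lemma quintic_gap_moment:
  obtains k c where "\<And>x. x^5 - (k \<bullet> moment x + c) = (x - a) * ((x - b) * (x - p)) * (x - q)^2"
proof
  \<comment> \<open>By Vieta the entries are signed elementary symmetric polynomials in the roots
    \<open>a, b, p, q, q\<close>, and the constant is their product.\<close>
  let ?k = "vector4 (-(a*b*p*q + a*b*p*q + a*b*q*q + a*p*q*q + b*p*q*q))
      (a*b*p + a*b*q + a*b*q + a*p*q + a*p*q + a*q*q + b*p*q + b*p*q + b*q*q + p*q*q)
      (-(a*b + a*p + a*q + a*q + b*p + b*q + b*q + p*q + p*q + q*q)) (a + b + p + q + q)"
  show "x^5 - (?k \<bullet> moment x + a*b*p*q*q) = (x - a) * ((x - b) * (x - p)) * (x - q)^2" for x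
    unfolding moment_def inner_vector4 by algebra
qed

text \<open>Nonnegativity matters only at natural numbers. Four of the roots form pairs of equal or
  consecutive numbers; the fifth is \<open>-1\<close> or \<open>0\<close>, never above a natural
  number.\<close>

lemma moment_support:
  fixes s :: "nat set"
  assumes "finite s" "card s \<le> 2 \<or> (\<exists>p q. s = {0, p, q}) \<or> (\<exists>p q. s = {p, Suc p, q})"
  shows "\<exists>k c. \<forall>m::nat. k \<bullet> moment (real m) + c \<le> real m ^ 5 \<and>
           (real m ^ 5 = k \<bullet> moment (real m) + c \<longleftrightarrow> m \<in> s)"
proof -
  have *: ?thesis
    if "\<And>m::nat. 0 \<le> (real m - a) * ((real m - b) * (real m - p))"
      "\<And>m::nat. (real m - a) * ((real m - b) * (real m - p)) * (real m - q)^2 = 0 \<longleftrightarrow> m \<in> s"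
    for a b p q
  proof -
    obtain k c where k: "\<And>x. x^5 - (k \<bullet> moment x + c) = (x - a) * ((x - b) * (x - p)) * (x - q)^2"
      using quintic_gap_moment by blast
    have "0 \<le> real m ^ 5 - (k \<bullet> moment m + c)" for m :: nat
      unfolding k by (rule mult_nonneg_nonneg[OF that(1) zero_le_power2])
    moreover have "real m ^ 5 - (k \<bullet> moment m + c) = 0 \<longleftrightarrow> m \<in> s" for m :: nat
      unfolding k using that(2) .
    ultimately show ?thesis
      by (intro exI[of _ k] exI[of _ c]) auto
  qed
  consider (empty) "s = {}" | (two) p q where "s = {p, q}" | (apex) p q where "s = {0, p, q}"
    | (consecutive) p q where "s = {p, Suc p, q}"
  proof -
    have "\<exists>p q. s = {p, q}" if "s \<noteq> {}" "card s \<le> 2"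
    proof -
      have "card s = 1 \<or> card s = 2"
        using that assms(1) by (auto simp: le_Suc_eq numeral_2_eq_2)
      then show ?thesis
        by (metis card_1_singletonE card_2_iff insert_absorb2)
    qed
    then show thesis
      using assms(2) that by metis
  qed
  then show ?thesis
  proof cases
    case empty
    then show ?thesis
      by (intro *[of "-1" "-1" "-1" "-1"]) (auto simp: add_eq_0_iff)
  next
    case (two p q)
    then show ?thesis
      by (intro *[of "-1" p p q]) (auto simp: add_eq_0_iff)
  next
    case (apex p q)
    then show ?thesis
      by (intro *[of 0 p p q]) auto
  next
    case (consecutive p q)
    \<comment> \<open>No natural number lies strictly between \<open>p\<close> and
      \<open>Suc p\<close>.\<close>
    have "0 \<le> (real m - p) * (real m - Suc p)" for m
      by (cases "m \<le> p") (auto intro: mult_nonpos_nonpos mult_nonneg_nonneg)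
    with consecutive show ?thesis
      by (intro *[of "-1" p "Suc p" q]) (auto simp: add_eq_0_iff)
  qed
qed

text \<open>Passage from abstract triangles to geometry. The kernel condition may range over all
  pairs \<open>e\<close>, since a pair outside the complex lies in no triangle and gives an empty
  sum.\<close>

proposition moment_configuration:
  fixes pos :: "'v \<Rightarrow> nat" and T :: "'v set set"
  assumes V: "finite V" "inj_on pos V" and "T \<noteq> {}"
    and T: "\<And>t. t \<in> T \<Longrightarrow> t \<subseteq> V \<and> card t = 3"
    and adm: "\<And>t. t \<in> T \<Longrightarrow> \<exists>x y z. t = {x, y, z} \<and> (pos x = 0 \<or> pos y = Suc (pos x))"
  obtains \<Delta> :: "(real^4) set set" and \<beta> where
    "triangular_configuration \<Delta>"
    "bij_betw \<beta> T (triangles \<Delta>)"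
    "config_ker \<Delta> = {v \<in> GF2_space (triangles \<Delta>).
       \<forall>e. card e = 2 \<longrightarrow> (\<Sum>t | t \<in> T \<and> e \<subseteq> t. v (\<beta> t)) = 0}"
proof -
  define f where "f = (\<lambda>x. moment (real (pos x)))"
  define K where "K = {s. \<exists>t\<in>T. s \<subseteq> t}"
  have f: "inj_on f V"
    unfolding f_def using V(2) by (auto simp: inj_on_def inj_eq[OF inj_moment])
  have K: "finite s" "s \<subseteq> V" if "s \<in> K" for s
    using that T V(1) unfolding K_def by (auto intro: finite_subset[of _ V])
  have T_K: "T \<subseteq> K"
    by (auto simp: K_def)
  \<comment> \<open>The first coordinate of \<open>f x\<close> is \<open>pos x\<close>, so the
    height is the fifth power occurring in the quintic gaps.\<close>
  interpret lifted_complex "f ` V" "\<lambda>y. (y $ 1) ^ 5" "(`) f ` K"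
  proof
    show "finite (f ` V)"
      using V(1) by simp
  next
    fix s assume "s \<in> (`) f ` K"
    then show "s \<subseteq> f ` V"
      using K by auto
  next
    fix s r assume "s \<in> (`) f ` K" "r \<subseteq> s"
    then obtain s' where s': "s' \<in> K" "s = f ` s'"
      by auto
    then obtain r' where "r' \<subseteq> s'" "r = f ` r'"
      using \<open>r \<subseteq> s\<close> by (meson subset_imageE)
    then show "r \<in> (`) f ` K"
      using s' unfolding K_def by blast
  next
    fix s' assume "s' \<in> (`) f ` K"
    then obtain s t where s: "s' = f ` s" "t \<in> T" "s \<subseteq> t"
      by (auto simp: K_def)
    then have "card t = 3" "t \<subseteq> V"
      using T by auto
    then have sV: "s \<subseteq> V" "finite s" and "finite t"
      using s(3) V(1) by (auto intro: finite_subset)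
    \<comment> \<open>A member of \<open>K\<close> is either a triangle, covered by
      \<open>adm\<close>, or a proper part of one with at most two vertices.\<close>
    have "card (pos ` s) \<le> 2 \<or> (\<exists>p q. pos ` s = {0, p, q}) \<or> (\<exists>p q. pos ` s = {p, Suc p, q})"
    proof (cases "s = t")
      case True
      then obtain x y z where "s = {x, y, z}" "pos x = 0 \<or> pos y = Suc (pos x)"
        using adm s(2) by blast
      then have "pos ` s = {0, pos y, pos z} \<or> pos ` s = {pos x, Suc (pos x), pos z}"
        by auto
      then show ?thesis
        by metis
    next
      case False
      then have "card s < 3"
        using s(3) \<open>finite t\<close> \<open>card t = 3\<close> psubset_card_mono[of t s] by auto
      then show ?thesis
        using card_image_le[OF sV(2), of pos] by linarith
    qed
    from moment_support[OF finite_imageI[OF sV(2)] this] obtain k c where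
      k: "\<forall>m::nat. k \<bullet> moment (real m) + c \<le> real m ^ 5 \<and>
        (real m ^ 5 = k \<bullet> moment (real m) + c \<longleftrightarrow> m \<in> pos ` s)"
      by (elim exE)
    have "f x $ 1 = real (pos x)" for x
      by (simp add: f_def moment_def vector4_def)
    moreover have "pos x \<in> pos ` s \<longleftrightarrow> f x \<in> f ` s" if "x \<in> V" for x
      using that sV(1) V(2) f by (simp add: inj_on_image_mem_iff)
    ultimately show "\<exists>k c. \<forall>y\<in>f ` V. k \<bullet> y + c \<le> (y $ 1) ^ 5 \<and> ((y $ 1) ^ 5 = k \<bullet> y + c \<longleftrightarrow> y \<in> s')"
      using k s(1) by (intro exI[of _ k] exI[of _ c]) (auto simp: f_def)
  qed
  define \<beta> where "\<beta> s = convex hull (f ` s)" for s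
  define \<Delta> where "\<Delta> = \<beta> ` K"
  have \<Delta>_hull: "\<Delta> = (hull) convex ` (`) f ` K"
    by (auto simp: \<Delta>_def \<beta>_def)
  have card_f: "card (f ` s) = card s" if "s \<in> K" for s
    using K(2)[OF that] f by (meson card_image inj_on_subset)
  have simplex_\<beta>: "k simplex \<beta> s \<longleftrightarrow> int (card s) = k + 1" if "s \<in> K" for k s
    using simplex_hull_iff[of "f ` s" k] that by (simp add: \<beta>_def card_f)
  have face_\<beta>: "\<beta> r face_of \<beta> s \<longleftrightarrow> r \<subseteq> s" if "s \<in> K" "r \<in> K" for s r
    using convex_hull_face_iff[of "f ` s" "f ` r"] that inj_on_image_subset_iff[OF f K(2) K(2)]
    by (simp add: \<beta>_def)
  have inj_\<beta>: "inj_on \<beta> K"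
  proof (rule inj_onI)
    fix s r assume "s \<in> K" "r \<in> K" "\<beta> s = \<beta> r"
    then show "s = r"
      using face_\<beta>[of s r] face_\<beta>[of r s] face_\<beta>[of s s] by auto
  qed
  have K3: "s \<in> T" if s: "s \<in> K" "card s = 3" for s
  proof -
    obtain t where t: "t \<in> T" "s \<subseteq> t"
      using s(1) K_def by blast
    then have "s = t"
      using T[OF t(1)] s(2) by (intro card_subset_eq) (auto intro: card_ge_0_finite)
    then show ?thesis
      using t by simp
  qed
  have triangles: "triangles \<Delta> = \<beta> ` T"
    using K3 T T_K simplex_\<beta>[of _ 2] by (auto simp: triangles_def \<Delta>_def)
  have bij: "bij_betw \<beta> T (triangles \<Delta>)"
    using inj_on_subset[OF inj_\<beta> T_K] by (simp add: triangles bij_betw_def)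
  have edges: "edges \<Delta> = \<beta> ` {e \<in> K. card e = 2}"
    using simplex_\<beta>[of _ 1] by (auto simp: edges_def \<Delta>_def)
  have finT: "finite T"
    using T V(1) by (auto intro: finite_subset[of _ "Pow V"])
  have config: "triangular_configuration \<Delta>"
    unfolding triangular_configuration_def
  proof (intro conjI ballI impI)
    show "simplicial_complex \<Delta>"
      unfolding \<Delta>_hull by (rule simplicial_complex_hulls)
  next
    show "\<exists>\<sigma>\<in>\<Delta>. 2 simplex \<sigma>"
      using \<open>T \<noteq> {}\<close> triangles unfolding triangles_def by blast
  next
    \<comment> \<open>Every simplex lies in a triangle of the complex, so a maximal one is itself a
      triangle.\<close>
    fix \<sigma> assume *: "\<sigma> \<in> \<Delta>" "\<forall>\<tau>\<in>\<Delta>. \<sigma> \<subseteq> \<tau> \<longrightarrow> \<tau> = \<sigma>"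
    then obtain s t where st: "\<sigma> = \<beta> s" "s \<subseteq> t" "t \<in> T"
      by (auto simp: \<Delta>_def K_def)
    then have "\<sigma> \<subseteq> \<beta> t"
      by (simp add: \<beta>_def hull_mono image_mono)
    moreover have "\<beta> t \<in> triangles \<Delta>"
      using st(3) triangles by blast
    ultimately have "\<beta> t = \<sigma>" "\<beta> t \<in> triangles \<Delta>"
      using *(2) by (auto simp: triangles_def)
    then have "\<sigma> \<in> triangles \<Delta>"
      by simp
    then show "2 simplex \<sigma> \<or> 1 simplex \<sigma>"
      by (simp add: triangles_def)
  qed
  have sum_eq: "(\<Sum>t\<in>triangles \<Delta>. incidence (\<beta> e) t * v t) = (\<Sum>t | t \<in> T \<and> e \<subseteq> t. v (\<beta> t))"
    if "e \<in> K" for e and v :: "_ \<Rightarrow> bit"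
  proof -
    have "(\<Sum>t\<in>triangles \<Delta>. incidence (\<beta> e) t * v t) = (\<Sum>t\<in>T. incidence (\<beta> e) (\<beta> t) * v (\<beta> t))"
      using sum.reindex_bij_betw[OF bij, of "\<lambda>t. incidence (\<beta> e) t * v t"] by simp
    also have "\<dots> = (\<Sum>t | t \<in> T \<and> e \<subseteq> t. v (\<beta> t))"
      using finT T_K face_\<beta> that by (intro sum.mono_neutral_cong_right) (auto simp: incidence_def)
    finally show ?thesis .
  qed
  have zero: "(\<Sum>t | t \<in> T \<and> e \<subseteq> t. v (\<beta> t)) = 0" if "e \<notin> K" for e and v :: "_ \<Rightarrow> bit"
    using that by (intro sum.neutral) (auto simp: K_def)
  have "(\<forall>e\<in>edges \<Delta>. (\<Sum>t\<in>triangles \<Delta>. incidence e t * v t) = 0) \<longleftrightarrow>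
      (\<forall>e. card e = 2 \<longrightarrow> (\<Sum>t | t \<in> T \<and> e \<subseteq> t. v (\<beta> t)) = 0)" (is "?L \<longleftrightarrow> ?R") for v
  proof
    assume ?L
    then have "(\<Sum>t | t \<in> T \<and> e \<subseteq> t. v (\<beta> t)) = 0" if "e \<in> K" "card e = 2" for e
      using that sum_eq[of e v] edges by auto
    then show ?R
      using zero by metis
  next
    assume ?R
    then show ?L
      using sum_eq[of _ v] edges by auto
  qed
  then have "config_ker \<Delta> = {v \<in> GF2_space (triangles \<Delta>).
       \<forall>e. card e = 2 \<longrightarrow> (\<Sum>t | t \<in> T \<and> e \<subseteq> t. v (\<beta> t)) = 0}"
    by (simp add: config_ker_def)
  then show thesis
    using that config bij by blast
qed

subsection \<open>Sheets and checks\<close>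

declare add_bit_eq_xor [simp del] mult_bit_eq_and [simp del]

lemma bit_double [simp]: "b + b = (0::bit)"
  by (cases b) auto

lemma bit_add_eq_0_iff: "a + b = (0::bit) \<longleftrightarrow> a = b"
  by (cases a; cases b) auto

text \<open>For a pair \<open>e\<close> this is the coefficient at \<open>e\<close> of the mod 2
  boundary of the chain \<open>w\<close>.\<close>

definition star_sum :: "'v set set \<Rightarrow> ('v set \<Rightarrow> bit) \<Rightarrow> 'v set \<Rightarrow> bit" where
  "star_sum T w e = (\<Sum>t | t \<in> T \<and> e \<subseteq> t. w t)"

text \<open>
  Coning off the edges outside \<open>G\<close> drops their cycle conditions: the value on a cone triangle is
  free to compensate, and the conditions at the edges through the apex hold since every triangle
  of \<open>X\<close> contains exactly zero or two edges through a given vertex.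
\<close>

definition cone_off :: "'v \<Rightarrow> 'v set \<Rightarrow> 'v set set \<Rightarrow> 'v set set \<Rightarrow> 'v set set" where
  "cone_off a W X G = X \<union> insert a ` {e. e \<subseteq> W \<and> card e = 2 \<and> e \<notin> G}"

context
  fixes a :: 'v and W :: "'v set" and X G :: "'v set set"
  assumes fin: "finite W" and apex: "a \<notin> W" and X: "\<And>t. t \<in> X \<Longrightarrow> t \<subseteq> W \<and> card t = 3"
begin

lemma finite_sheets: "finite X"
  using X fin by (auto intro: finite_subset[of _ "Pow W"])

lemma star_sum_base:
  assumes "e \<subseteq> W" "card e = 2"
  shows "star_sum (cone_off a W X G) w e = star_sum X w e + (if e \<in> G then 0 else w (insert a e))"
proof -
  \<comment> \<open>A pair inside \<open>W\<close> contained in a cone triangle is its base, so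
    coning adds at most one triangle at \<open>e\<close>.\<close>
  have "e = e'" if "e \<subseteq> insert a e'" "e' \<subseteq> W" "card e' = 2" for e'
    using that assms apex fin by (intro card_subset_eq) (auto intro: finite_subset)
  then have "{t. t \<in> cone_off a W X G \<and> e \<subseteq> t} = {t. t \<in> X \<and> e \<subseteq> t} \<union> (if e \<in> G then {} else {insert a e})"
    using assms by (auto simp: cone_off_def)
  moreover have "insert a e \<notin> X"
    using X apex by blast
  ultimately show ?thesis
    using finite_sheets by (auto simp: star_sum_def)
qed

lemma star_sum_apex:
  assumes x: "x \<in> W" and G: "\<And>e. e \<in> G \<Longrightarrow> e \<subseteq> W \<Longrightarrow> card e = 2 \<Longrightarrow> star_sum X w e = 0"
    and cone: "\<And>e. e \<subseteq> W \<Longrightarrow> card e = 2 \<Longrightarrow> e \<notin> G \<Longrightarrow> w (insert a e) = star_sum X w e"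
  shows "star_sum (cone_off a W X G) w {a, x} = 0"
proof -
  let ?Y = "{y \<in> W - {x}. {x, y} \<notin> G}"
  have "{t. t \<in> cone_off a W X G \<and> {a, x} \<subseteq> t} = (\<lambda>y. {a, x, y}) ` ?Y"
  proof (intro equalityI subsetI)
    fix t assume "t \<in> {t. t \<in> cone_off a W X G \<and> {a, x} \<subseteq> t}"
    then obtain e where e: "t = insert a e" "e \<subseteq> W" "card e = 2" "e \<notin> G" "x \<in> e"
      using X apex x by (auto simp: cone_off_def)
    then obtain y where "e = {x, y}" "y \<noteq> x"
      by (auto simp: card_2_iff)
    then show "t \<in> (\<lambda>y. {a, x, y}) ` ?Y"
      using e by auto
  next
    fix t assume "t \<in> (\<lambda>y. {a, x, y}) ` ?Y"
    then obtain y where y: "y \<in> W" "y \<noteq> x" "{x, y} \<notin> G" "t = insert a {x, y}"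
      by blast
    then have "{x, y} \<in> {e. e \<subseteq> W \<and> card e = 2 \<and> e \<notin> G}"
      using x by simp
    then show "t \<in> {t. t \<in> cone_off a W X G \<and> {a, x} \<subseteq> t}"
      unfolding cone_off_def y(4) by blast
  qed
  moreover have "inj_on (\<lambda>y. {a, x, y}) ?Y"
  proof (rule inj_onI)
    fix y z assume "y \<in> ?Y" "z \<in> ?Y" and eq: "{a, x, y} = {a, x, z}"
    then have "y \<noteq> a" "y \<noteq> x"
      using apex by auto
    moreover have "y \<in> {a, x, z}"
      unfolding eq[symmetric] by simp
    ultimately show "y = z"
      by simp
  qed
  ultimately have "star_sum (cone_off a W X G) w {a, x} = (\<Sum>y\<in>?Y. w {a, x, y})"
    by (simp add: star_sum_def sum.reindex)
  \<comment> \<open>Edges in \<open>G\<close> carry no cone triangle; including them is harmless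
    because their star sums vanish by assumption.\<close>
  also have "\<dots> = (\<Sum>y\<in>W - {x}. star_sum X w {x, y})"
    using cone G x fin by (intro sum.mono_neutral_cong_left) auto
  also have "\<dots> = (\<Sum>y\<in>W - {x}. \<Sum>t\<in>X. if {x, y} \<subseteq> t then w t else 0)"
    unfolding star_sum_def using finite_sheets by (simp add: sum.inter_filter)
  also have "\<dots> = (\<Sum>t\<in>X. \<Sum>y\<in>W - {x}. if {x, y} \<subseteq> t then w t else 0)"
    by (rule sum.swap)
  also have "\<dots> = 0"
  proof (rule sum.neutral, rule ballI)
    fix t assume t: "t \<in> X"
    show "(\<Sum>y\<in>W - {x}. if {x, y} \<subseteq> t then w t else 0) = 0"
    proof (cases "x \<in> t")
      case True
      then obtain y z where yz: "t = {x, y, z}" "y \<noteq> x" "z \<noteq> x" "y \<noteq> z"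
        using X[OF t] by (auto simp: card_3_iff)
      \<comment> \<open>Exactly two edges of \<open>t\<close> contain \<open>x\<close>, and their
        equal terms cancel mod 2.\<close>
      have "(\<Sum>y\<in>W - {x}. if {x, y} \<subseteq> t then w t else 0) = (\<Sum>y\<in>{y, z}. w t)"
        using yz X[OF t] fin by (intro sum.mono_neutral_cong_right) auto
      then show ?thesis
        using yz by simp
    qed auto
  qed
  finally show ?thesis .
qed

text \<open>Pairs through the apex impose nothing new by \<open>star_sum_apex\<close>, and pairs not
  inside \<open>insert a W\<close> lie in no triangle. Only pairs inside \<open>W\<close>
  remain.\<close>

lemma star_sum_cone_off_iff:
  "(\<forall>e. card e = 2 \<longrightarrow> star_sum (cone_off a W X G) w e = 0) \<longleftrightarrow>
    (\<forall>e. e \<subseteq> W \<longrightarrow> card e = 2 \<longrightarrow> (if e \<in> G then star_sum X w e = 0 else w (insert a e) = star_sum X w e))"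
    (is "?L \<longleftrightarrow> ?R")
proof
  assume ?L
  then show ?R
    using star_sum_base by (auto simp: bit_add_eq_0_iff)
next
  assume R: ?R
  show ?L
  proof (intro allI impI)
    fix e :: "'v set" assume e: "card e = 2"
    consider "e \<subseteq> W" | x where "x \<in> W" "e = {a, x}" | "\<not> e \<subseteq> insert a W"
    proof -
      have "\<exists>x\<in>W. e = {a, x}" if "\<not> e \<subseteq> W" "e \<subseteq> insert a W"
        using e that apex by (auto simp: card_2_iff)
      then show thesis
        using that by metis
    qed
    then show "star_sum (cone_off a W X G) w e = 0"
    proof cases
      case 1
      then show ?thesis
        using R e star_sum_base by auto
    next
      case 2
      then show ?thesis
        using R star_sum_apex by metis
    next
      case 3
      then have "{t. t \<in> cone_off a W X G \<and> e \<subseteq> t} = {}"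
        using X by (force simp: cone_off_def)
      then show ?thesis
        by (simp only: star_sum_def sum.empty)
    qed
  qed
qed

end

section \<open>The sheet complex of a parity check matrix\<close>

datatype vertex = Apex | Hub | Lft nat | Rgt nat | Rim nat nat

locale check_complex =
  fixes n :: nat and H :: "nat \<Rightarrow> nat \<Rightarrow> bit"
begin

text \<open>
  The sheet of coordinate \<open>i\<close> is a fan around the hub; for every check \<open>j\<close> containing \<open>i\<close> a
  flap leads from its rim to the edge \<open>{Lft j, Rgt j}\<close>, where all sheets of check \<open>j\<close> meet.
\<close>

definition fan :: "nat \<Rightarrow> nat \<Rightarrow> vertex set" where
  "fan i j = {Hub, Rim i j, Rim i (Suc j)}"

definition flap :: "nat \<Rightarrow> nat \<Rightarrow> vertex set" where
  "flap i j = {Rgt j, Rim i j, Rim i (Suc j)}"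

text \<open>The rim edge and the check edge are disjoint, so the strip joining them takes two
  triangles: the flap and, across \<open>{Rgt j, Rim i j}\<close>, the tag.\<close>

definition tag :: "nat \<Rightarrow> nat \<Rightarrow> vertex set" where
  "tag i j = {Lft j, Rgt j, Rim i j}"

text \<open>A fan of \<open>n\<close> triangles has \<open>n + 1\<close> rim vertices. Index
  \<open>0\<close> of \<open>Lft\<close> and \<open>Rgt\<close> belongs to no sheet;
  \<open>Lft 0\<close> yields a cone triangle even for \<open>n = 0\<close>.\<close>

definition base :: "vertex set" where
  "base = insert Hub (Lft ` {..n} \<union> Rgt ` {..n} \<union> case_prod Rim ` ({1..n} \<times> {1..Suc n}))"

text \<open>Every edge of sheet \<open>i\<close> except the check edges contains some
  \<open>Rim i j\<close>, so distinct sheets share no other edges.\<close>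

definition sheets :: "vertex set set" where
  "sheets = {t. \<exists>i\<in>{1..n}. \<exists>j\<in>{1..n}. t = fan i j \<or> H j i = 1 \<and> (t = flap i j \<or> t = tag i j)}"

text \<open>These are the edges whose cycle conditions survive. Spokes, rim edges and flap edges lie
  in two triangles of one sheet and force equal values; the spoke at \<open>j = 1\<close> is the
  free start of the fan.\<close>

definition glued :: "vertex set set" where
  "glued = {e. \<exists>i\<in>{1..n}. \<exists>j\<in>{1..n}. j \<noteq> 1 \<and> e = {Hub, Rim i j} \<or>
      H j i = 1 \<and> (e = {Rim i j, Rim i (Suc j)} \<or> e = {Rgt j, Rim i j}) \<or> e = {Lft j, Rgt j}}"

definition faces :: "vertex set set" where
  "faces = cone_off Apex base sheets glued"

lemmas sheet_defs = fan_def flap_def tag_def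

lemma finite_base: "finite base"
  by (simp add: base_def)

lemma Apex_base: "Apex \<notin> base"
  by (auto simp: base_def)

lemma sheets_base: "t \<in> sheets \<Longrightarrow> t \<subseteq> base \<and> card t = 3"
  by (auto simp: sheets_def sheet_defs base_def)

lemma faces_vertices:
  assumes "t \<in> faces" shows "t \<subseteq> insert Apex base \<and> card t = 3"
proof -
  have "insert Apex e \<subseteq> insert Apex base \<and> card (insert Apex e) = 3" if "e \<subseteq> base" "card e = 2" for e
    using that Apex_base finite_subset[OF that(1) finite_base] by (subst card_insert_disjoint) auto
  then show ?thesis
    using assms sheets_base unfolding faces_def cone_off_def by blast
qed

lemma glued_base: "e \<in> glued \<Longrightarrow> e \<subseteq> base \<and> card e = 2"
  by (auto simp: glued_def base_def)

text \<open>\<open>Lft j\<close> directly precedes \<open>Rgt j\<close>, and \<open>Rim i j\<close>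
  directly precedes \<open>Rim i (Suc j)\<close>, so each sheet triangle has two consecutive
  vertices. The stride \<open>n + 2\<close> exceeds the largest rim index \<open>n + 1\<close>,
  which keeps different sheets apart.\<close>

definition pos :: "vertex \<Rightarrow> nat" where
  "pos x = (case x of Apex \<Rightarrow> 0 | Hub \<Rightarrow> 1 | Lft j \<Rightarrow> 2 * j + 2 | Rgt j \<Rightarrow> 2 * j + 3
     | Rim i j \<Rightarrow> 2 * n + 4 + (j + i * (n + 2)))"

lemma inj_on_pos: "inj_on pos (insert Apex base)"
proof -
  have *: "i = i' \<and> j = j'"
    if "j + i * (n + 2) = j' + i' * (n + 2)" "j < n + 2" "j' < n + 2" for i j i' j'
  proof -
    have "(j + i * (n + 2)) div (n + 2) = i" "(j' + i' * (n + 2)) div (n + 2) = i'"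
      using that(2,3) by (subst div_mult_self1; simp)+
    then have "i = i'"
      using that(1) by metis
    then show ?thesis
      using that(1) by simp
  qed
  show ?thesis
  proof (rule inj_onI)
    fix x y assume "x \<in> insert Apex base" "y \<in> insert Apex base" "pos x = pos y"
    then show "x = y"
      using *[of "case x of Rim i j \<Rightarrow> j" "case x of Rim i j \<Rightarrow> i" "case y of Rim i j \<Rightarrow> j" "case y of Rim i j \<Rightarrow> i"]
      unfolding base_def by (cases x; cases y) (auto simp: pos_def, presburger+)
  qed
qed

lemma faces_consecutive:
  assumes "t \<in> faces"
  shows "\<exists>x y z. t = {x, y, z} \<and> (pos x = 0 \<or> pos y = Suc (pos x))"
proof -
  consider "t \<in> sheets" | e where "t = insert Apex e" "card e = 2"
    using assms by (auto simp: faces_def cone_off_def)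
  then show ?thesis
  proof cases
    case 1
    then obtain i j where "t = {Rim i j, Rim i (Suc j), Hub} \<or> t = {Rim i j, Rim i (Suc j), Rgt j} \<or>
        t = {Lft j, Rgt j, Rim i j}"
      unfolding sheets_def sheet_defs by blast
    moreover have "pos (Rim i (Suc j)) = Suc (pos (Rim i j))" "pos (Rgt j) = Suc (pos (Lft j))"
      by (auto simp: pos_def)
    ultimately show ?thesis
      by metis
  next
    case 2
    then obtain x y where "t = {Apex, x, y}"
      by (auto simp: card_2_iff)
    moreover have "pos Apex = 0"
      by (simp add: pos_def)
    ultimately show ?thesis
      by metis
  qed
qed

lemma faces_nonempty: "faces \<noteq> {}"
proof -
  have "{Hub, Lft 0} \<notin> glued" "{Hub, Lft 0} \<subseteq> base"
    by (auto simp: glued_def base_def doubleton_eq_iff)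
  then have "insert Apex {Hub, Lft 0} \<in> faces"
    unfolding faces_def cone_off_def by (intro UnI2 imageI) auto
  then show ?thesis
    by blast
qed

section \<open>Sheet triangles at the glued edges\<close>

lemma sheetsI:
  assumes "i \<in> {1..n}" "j \<in> {1..n}"
  shows "fan i j \<in> sheets" "H j i = 1 \<Longrightarrow> flap i j \<in> sheets" "H j i = 1 \<Longrightarrow> tag i j \<in> sheets"
  using assms unfolding sheets_def by blast+

lemma gluedI:
  assumes "i \<in> {1..n}" "j \<in> {1..n}"
  shows "j \<noteq> 1 \<Longrightarrow> {Hub, Rim i j} \<in> glued" "H j i = 1 \<Longrightarrow> {Rim i j, Rim i (Suc j)} \<in> glued"
    "H j i = 1 \<Longrightarrow> {Rgt j, Rim i j} \<in> glued" "{Lft j, Rgt j} \<in> glued"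
  unfolding glued_def using assms by (intro CollectI bexI[of _ i] bexI[of _ j]; simp)+

lemma sheetsE:
  assumes "t \<in> sheets"
  obtains i j where "i \<in> {1..n}" "j \<in> {1..n}" "t = fan i j"
  | i j where "i \<in> {1..n}" "j \<in> {1..n}" "H j i = 1" "t = flap i j"
  | i j where "i \<in> {1..n}" "j \<in> {1..n}" "H j i = 1" "t = tag i j"
  using assms unfolding sheets_def by blast

lemma star_hub:
  assumes "i \<in> {1..n}" "j \<in> {1..n}" "j \<noteq> 1"
  shows "star_sum sheets w {Hub, Rim i j} = w (fan i (j - 1)) + w (fan i j)"
proof -
  have pred: "j - 1 \<in> {1..n}"
    using assms by auto
  have "{t. t \<in> sheets \<and> {Hub, Rim i j} \<subseteq> t} = {fan i (j - 1), fan i j}"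
  proof (intro equalityI subsetI)
    fix t assume "t \<in> {t. t \<in> sheets \<and> {Hub, Rim i j} \<subseteq> t}"
    then have "t \<in> sheets" "{Hub, Rim i j} \<subseteq> t"
      by simp_all
    then show "t \<in> {fan i (j - 1), fan i j}"
      by (cases rule: sheetsE) (auto simp: sheet_defs)
  next
    fix t assume "t \<in> {fan i (j - 1), fan i j}"
    then show "t \<in> {t. t \<in> sheets \<and> {Hub, Rim i j} \<subseteq> t}"
      using assms sheetsI(1)[of i j] sheetsI(1)[OF assms(1) pred] by (auto simp: sheet_defs)
  qed
  moreover have "fan i (j - 1) \<noteq> fan i j"
  proof -
    have "Rim i (j - 1) \<in> fan i (j - 1)" "Rim i (j - 1) \<notin> fan i j"
      using assms by (auto simp: fan_def)
    then show ?thesis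
      by metis
  qed
  ultimately show ?thesis
    by (simp add: star_sum_def)
qed

lemma star_rim:
  assumes "i \<in> {1..n}" "j \<in> {1..n}" "H j i = 1"
  shows "star_sum sheets w {Rim i j, Rim i (Suc j)} = w (fan i j) + w (flap i j)"
proof -
  have "{t. t \<in> sheets \<and> {Rim i j, Rim i (Suc j)} \<subseteq> t} = {fan i j, flap i j}"
  proof (intro equalityI subsetI)
    fix t assume "t \<in> {t. t \<in> sheets \<and> {Rim i j, Rim i (Suc j)} \<subseteq> t}"
    then have "t \<in> sheets" "{Rim i j, Rim i (Suc j)} \<subseteq> t"
      by simp_all
    then show "t \<in> {fan i j, flap i j}"
      by (cases rule: sheetsE) (auto simp: sheet_defs)
  next
    fix t assume "t \<in> {fan i j, flap i j}"
    then show "t \<in> {t. t \<in> sheets \<and> {Rim i j, Rim i (Suc j)} \<subseteq> t}"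
      using assms sheetsI by (auto simp: sheet_defs)
  qed
  moreover have "fan i j \<noteq> flap i j"
    by (auto simp: fan_def flap_def)
  ultimately show ?thesis
    by (simp add: star_sum_def)
qed

lemma star_flap:
  assumes "i \<in> {1..n}" "j \<in> {1..n}" "H j i = 1"
  shows "star_sum sheets w {Rgt j, Rim i j} = w (flap i j) + w (tag i j)"
proof -
  have "{t. t \<in> sheets \<and> {Rgt j, Rim i j} \<subseteq> t} = {flap i j, tag i j}"
  proof (intro equalityI subsetI)
    fix t assume "t \<in> {t. t \<in> sheets \<and> {Rgt j, Rim i j} \<subseteq> t}"
    then have "t \<in> sheets" "{Rgt j, Rim i j} \<subseteq> t"
      by simp_all
    then show "t \<in> {flap i j, tag i j}"
      by (cases rule: sheetsE) (auto simp: sheet_defs)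
  next
    fix t assume "t \<in> {flap i j, tag i j}"
    then show "t \<in> {t. t \<in> sheets \<and> {Rgt j, Rim i j} \<subseteq> t}"
      using assms sheetsI by (auto simp: sheet_defs)
  qed
  moreover have "flap i j \<noteq> tag i j"
    by (auto simp: tag_def flap_def)
  ultimately show ?thesis
    by (simp add: star_sum_def)
qed

text \<open>Each coordinate in check \<open>j\<close> contributes one tag, distinct for distinct
  \<open>i\<close>; the factor \<open>H j i\<close> turns the sum over these coordinates into a row
  of the parity check.\<close>

lemma star_tag:
  assumes "j \<in> {1..n}"
  shows "star_sum sheets w {Lft j, Rgt j} = (\<Sum>i=1..n. H j i * w (tag i j))"
proof -
  have "{t. t \<in> sheets \<and> {Lft j, Rgt j} \<subseteq> t} = (\<lambda>i. tag i j) ` {i \<in> {1..n}. H j i = 1}"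
  proof (intro equalityI subsetI)
    fix t assume "t \<in> {t. t \<in> sheets \<and> {Lft j, Rgt j} \<subseteq> t}"
    then have "t \<in> sheets" "{Lft j, Rgt j} \<subseteq> t"
      by simp_all
    then show "t \<in> (\<lambda>i. tag i j) ` {i \<in> {1..n}. H j i = 1}"
      by (cases rule: sheetsE) (auto simp: sheet_defs)
  next
    fix t assume "t \<in> (\<lambda>i. tag i j) ` {i \<in> {1..n}. H j i = 1}"
    then show "t \<in> {t. t \<in> sheets \<and> {Lft j, Rgt j} \<subseteq> t}"
      using assms sheetsI by (auto simp: sheet_defs)
  qed
  moreover have "inj_on (\<lambda>i. tag i j) {i \<in> {1..n}. H j i = 1}"
    by (auto simp: inj_on_def tag_def)
  ultimately have "star_sum sheets w {Lft j, Rgt j} = (\<Sum>i | i \<in> {1..n} \<and> H j i = 1. w (tag i j))"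
    by (simp add: star_sum_def sum.reindex)
  also have "\<dots> = (\<Sum>i=1..n. H j i * w (tag i j))"
    by (intro sum.mono_neutral_cong_left) auto
  finally show ?thesis .
qed

section \<open>Cycles, sheet values and parity checks\<close>

definition constant_on_sheets :: "(vertex set \<Rightarrow> bit) \<Rightarrow> (nat \<Rightarrow> bit) \<Rightarrow> bool" where
  "constant_on_sheets w x \<longleftrightarrow> (\<forall>i\<in>{1..n}. \<forall>j\<in>{1..n}. w (fan i j) = x i \<and>
      (H j i = 1 \<longrightarrow> w (flap i j) = x i \<and> w (tag i j) = x i))"

lemma constant_on_sheets_tag:
  assumes "constant_on_sheets w x" "j \<in> {1..n}" "i \<in> {1..n}"
  shows "H j i * w (tag i j) = H j i * x i"
  using assms by (cases "H j i = 1") (simp_all add: constant_on_sheets_def)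

lemma constant_on_sheets_cong:
  "constant_on_sheets w x \<Longrightarrow> (\<And>i. i \<in> {1..n} \<Longrightarrow> y i = x i) \<Longrightarrow> constant_on_sheets w y"
  by (simp add: constant_on_sheets_def)

lemma constant_on_sheets_unique:
  assumes "constant_on_sheets w x" "constant_on_sheets w' x" "t \<in> sheets"
  shows "w t = w' t"
  using assms(3,1,2) by (cases rule: sheetsE) (simp_all add: constant_on_sheets_def)

text \<open>At spokes, rim edges and flap edges two equal values cancel; at a check edge the star
  sum is the parity check of \<open>x\<close>.\<close>

lemma constant_on_sheets_glued:
  assumes "constant_on_sheets w x" "\<And>j. j \<in> {1..n} \<Longrightarrow> (\<Sum>i=1..n. H j i * x i) = 0" "e \<in> glued"
  shows "star_sum sheets w e = 0"
proof -
  obtain i j where ij: "i \<in> {1..n}" "j \<in> {1..n}" and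
    "j \<noteq> 1 \<and> e = {Hub, Rim i j} \<or>
      H j i = 1 \<and> (e = {Rim i j, Rim i (Suc j)} \<or> e = {Rgt j, Rim i j}) \<or> e = {Lft j, Rgt j}"
    using assms(3) unfolding glued_def by blast
  then consider "j \<noteq> 1" "e = {Hub, Rim i j}" | "H j i = 1" "e = {Rim i j, Rim i (Suc j)}"
    | "H j i = 1" "e = {Rgt j, Rim i j}" | "e = {Lft j, Rgt j}"
    by blast
  then show ?thesis
  proof cases
    case 1
    then have "j - 1 \<in> {1..n}"
      using ij by auto
    then show ?thesis
      using assms(1) ij 1 by (simp add: star_hub constant_on_sheets_def)
  next
    case 2
    then show ?thesis
      using assms(1) ij by (simp add: star_rim constant_on_sheets_def)
  next
    case 3
    then show ?thesis
      using assms(1) ij by (simp add: star_flap constant_on_sheets_def)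
  next
    case 4
    have "(\<Sum>i=1..n. H j i * w (tag i j)) = (\<Sum>i=1..n. H j i * x i)"
      using constant_on_sheets_tag[OF assms(1) ij(2)] by (intro sum.cong refl) simp
    then show ?thesis
      using assms(2) ij 4 by (simp add: star_tag)
  qed
qed

text \<open>Equality spreads from \<open>fan i 1\<close> across the spokes to the whole fan, then
  over rim edges to the flaps and on to the tags. The check edges then give the parity
  checks.\<close>

lemma glued_constant_on_sheets:
  assumes "\<And>e. e \<in> glued \<Longrightarrow> star_sum sheets w e = 0"
  shows "constant_on_sheets w (\<lambda>i. w (fan i 1))"
    and "j \<in> {1..n} \<Longrightarrow> (\<Sum>i=1..n. H j i * w (fan i 1)) = 0"
proof -
  have fan: "w (fan i j) = w (fan i 1)" if i: "i \<in> {1..n}" and "j \<in> {1..n}" for i j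
  proof -
    have "1 \<le> j" "j \<le> n"
      using that by auto
    then show ?thesis
    proof (induction j rule: dec_induct)
      case (step k)
      then have k: "Suc k \<in> {1..n}" "Suc k \<noteq> 1" and IH: "w (fan i k) = w (fan i 1)"
        by auto
      then have "w (fan i k) + w (fan i (Suc k)) = 0"
        using assms[OF gluedI(1)[OF i k]] star_hub[OF i k, of w] by simp
      then show ?case
        using IH by (simp add: bit_add_eq_0_iff)
    qed simp
  qed
  have "w (flap i j) = w (fan i j)" "w (tag i j) = w (flap i j)"
    if "i \<in> {1..n}" "j \<in> {1..n}" "H j i = 1" for i j
  proof -
    show "w (flap i j) = w (fan i j)" "w (tag i j) = w (flap i j)"
      using assms[OF gluedI(2)[OF that]] assms[OF gluedI(3)[OF that]]
        star_rim[OF that, of w] star_flap[OF that, of w]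
      by (simp_all add: bit_add_eq_0_iff)
  qed
  then show const: "constant_on_sheets w (\<lambda>i. w (fan i 1))"
    using fan unfolding constant_on_sheets_def by metis
  show "(\<Sum>i=1..n. H j i * w (fan i 1)) = 0" if j: "j \<in> {1..n}"
  proof -
    have "(\<Sum>i=1..n. H j i * w (tag i j)) = 0"
      using assms[OF gluedI(4)[OF j j]] star_tag[OF j, of w] by simp
    moreover have "(\<Sum>i=1..n. H j i * w (tag i j)) = (\<Sum>i=1..n. H j i * w (fan i 1))"
      using constant_on_sheets_tag[OF const j] by (intro sum.cong refl) simp
    ultimately show ?thesis
      by simp
  qed
qed

text \<open>All rim vertices of a sheet triangle carry the same first index.\<close>

definition sheet_index :: "vertex set \<Rightarrow> nat" where
  "sheet_index t = (THE i. \<exists>j. Rim i j \<in> t)"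

text \<open>The only possible extension of \<open>x\<close> to a cycle: a cone triangle must take
  the star sum at its base edge, which is recovered by removing \<open>Apex\<close>.\<close>

definition spread :: "(nat \<Rightarrow> bit) \<Rightarrow> vertex set \<Rightarrow> bit" where
  "spread x t = (if t \<in> sheets then x (sheet_index t)
     else star_sum sheets (\<lambda>t. x (sheet_index t)) (t - {Apex}))"

lemma constant_on_sheets_spread: "constant_on_sheets (spread x) x"
proof -
  have "sheet_index (fan i j) = i" "sheet_index (flap i j) = i" "sheet_index (tag i j) = i" for i j
    unfolding sheet_index_def sheet_defs by (rule the_equality; blast)+
  then show ?thesis
    using sheetsI by (simp add: constant_on_sheets_def spread_def)
qed

definition closed_chain :: "(vertex set \<Rightarrow> bit) \<Rightarrow> bool" where
  "closed_chain w \<longleftrightarrow> (\<forall>e. card e = 2 \<longrightarrow> star_sum faces w e = 0)"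

lemma closed_chain_iff:
  "closed_chain w \<longleftrightarrow> (\<forall>e\<in>glued. star_sum sheets w e = 0) \<and>
    (\<forall>e. e \<subseteq> base \<longrightarrow> card e = 2 \<longrightarrow> e \<notin> glued \<longrightarrow> w (insert Apex e) = star_sum sheets w e)"
proof -
  have "closed_chain w \<longleftrightarrow> (\<forall>e. e \<subseteq> base \<longrightarrow> card e = 2 \<longrightarrow>
      (if e \<in> glued then star_sum sheets w e = 0 else w (insert Apex e) = star_sum sheets w e))"
    unfolding closed_chain_def faces_def
    by (rule star_sum_cone_off_iff[OF finite_base Apex_base sheets_base])
  also have "\<dots> \<longleftrightarrow> (\<forall>e. e \<subseteq> base \<longrightarrow> card e = 2 \<longrightarrow> e \<in> glued \<longrightarrow> star_sum sheets w e = 0) \<and>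
      (\<forall>e. e \<subseteq> base \<longrightarrow> card e = 2 \<longrightarrow> e \<notin> glued \<longrightarrow> w (insert Apex e) = star_sum sheets w e)"
    unfolding if_bool_eq_conj by blast
  also have "(\<forall>e. e \<subseteq> base \<longrightarrow> card e = 2 \<longrightarrow> e \<in> glued \<longrightarrow> star_sum sheets w e = 0) \<longleftrightarrow>
      (\<forall>e\<in>glued. star_sum sheets w e = 0)"
    using glued_base by blast
  finally show ?thesis .
qed

lemma closed_chain_check:
  assumes "closed_chain w" "j \<in> {1..n}"
  shows "(\<Sum>i=1..n. H j i * w (fan i 1)) = 0"
  using assms glued_constant_on_sheets(2) by (auto simp: closed_chain_iff)

text \<open>The values at \<open>fan i 1\<close> fix all sheets, and the star sums of the sheets fix
  the cone. This yields injectivity of the restriction map.\<close>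

lemma closed_chain_determined:
  assumes w: "closed_chain w" "closed_chain w'" and eq: "\<And>i. i \<in> {1..n} \<Longrightarrow> w (fan i 1) = w' (fan i 1)"
    and t: "t \<in> faces"
  shows "w t = w' t"
proof -
  have const: "constant_on_sheets w (\<lambda>i. w (fan i 1))"
    using w glued_constant_on_sheets(1) by (auto simp: closed_chain_iff)
  have "constant_on_sheets w' (\<lambda>i. w' (fan i 1))"
    using w glued_constant_on_sheets(1) by (auto simp: closed_chain_iff)
  then have const': "constant_on_sheets w' (\<lambda>i. w (fan i 1))"
    by (rule constant_on_sheets_cong) (rule eq)
  have sheets: "w t = w' t" if "t \<in> sheets" for t
    by (rule constant_on_sheets_unique[OF const const' that])
  have "star_sum sheets w e = star_sum sheets w' e" for e
    unfolding star_sum_def by (intro sum.cong refl sheets) simp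
  then have "w (insert Apex e) = w' (insert Apex e)" if "e \<subseteq> base" "card e = 2" "e \<notin> glued" for e
    using w that by (simp add: closed_chain_iff)
  then show ?thesis
    using t sheets by (auto simp: faces_def cone_off_def)
qed

text \<open>This yields surjectivity: glued edges hold by sheetwise constancy and the checks, all
  others by the definition of \<open>spread\<close> on the cone.\<close>

lemma closed_chain_spread:
  assumes "\<And>j. j \<in> {1..n} \<Longrightarrow> (\<Sum>i=1..n. H j i * x i) = 0"
  shows "closed_chain (spread x)"
  unfolding closed_chain_iff
proof (intro conjI ballI allI impI)
  show "star_sum sheets (spread x) e = 0" if "e \<in> glued" for e
    using constant_on_sheets_glued[OF constant_on_sheets_spread assms that] .
next
  fix e assume "e \<subseteq> base" "card e = 2" "e \<notin> glued"
  then have "insert Apex e \<notin> sheets" "insert Apex e - {Apex} = e"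
    using sheets_base Apex_base by auto
  moreover have "star_sum sheets (spread x) e = star_sum sheets (\<lambda>t. x (sheet_index t)) e"
    unfolding star_sum_def by (intro sum.cong) (auto simp: spread_def)
  ultimately show "spread x (insert Apex e) = star_sum sheets (spread x) e"
    by (simp add: spread_def)
qed

lemma fan_faces: "i \<in> {1..n} \<Longrightarrow> fan i 1 \<in> faces"
  using sheetsI(1)[of i 1] unfolding faces_def cone_off_def by simp

lemma inj_fan: "inj_on (\<lambda>i. fan i j) I"
  by (auto simp: inj_on_def fan_def)

end

subsection \<open>Binary codes\<close>

text \<open>With only the scalars 0 and 1, subspaces and linear maps are characterized by addition
  alone.\<close>

lemma scale_bit_cases: "scale_bit c v = (if c = 1 then v else 0)"
  by (auto simp: scale_bit_def fun_eq_iff)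

lemma GF2_subspace_iff:
  "GF2.subspace V \<longleftrightarrow> 0 \<in> V \<and> (\<forall>x\<in>V. \<forall>y\<in>V. x + y \<in> V)"
  by (auto simp: GF2.subspace_def scale_bit_cases)

lemma GF2_linear_iff:
  fixes f :: "('x \<Rightarrow> bit) \<Rightarrow> 'y \<Rightarrow> bit"
  shows "Vector_Spaces.linear scale_bit scale_bit f \<longleftrightarrow> (\<forall>x y. f (x + y) = f x + f y)"
proof -
  have "f 0 = 0" if "\<forall>x y. f (x + y) = f x + f y"
    using that by (metis add_cancel_right_right)
  then show ?thesis
    unfolding Vector_Spaces.linear_iff
    by (auto simp: scale_bit_cases intro: GF2.vector_space_axioms)
qed

text \<open>A basis chosen inside \<open>V\<close> spans exactly \<open>V\<close>, so injectivity on
  \<open>V\<close> keeps its image independent.\<close>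

lemma GF2_dim_image:
  fixes f :: "('x \<Rightarrow> bit) \<Rightarrow> 'y \<Rightarrow> bit"
  assumes f: "Vector_Spaces.linear scale_bit scale_bit f" and "GF2.subspace V" "inj_on f V"
  shows "GF2.dim (f ` V) = GF2.dim V"
proof -
  interpret f: Vector_Spaces.linear scale_bit scale_bit f
    by (rule f)
  obtain B where B: "B \<subseteq> V" "GF2.independent B" "V \<subseteq> GF2.span B" "card B = GF2.dim V"
    using GF2.basis_exists by metis
  have span: "GF2.span B = V"
    using B assms(2) GF2.span_minimal by blast
  show ?thesis
  proof (rule GF2.dim_unique)
    show "f ` B \<subseteq> f ` V" "f ` V \<subseteq> GF2.span (f ` B)"
      using B f.span_image[of B] span by auto
    show "GF2.independent (f ` B)"
      using f.independent_injective_image[OF B(2)] span assms(3) by simp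
    show "card (f ` B) = GF2.dim V"
      using card_image[OF inj_on_subset[OF assms(3) B(1)]] B(4) by simp
  qed
qed

text \<open>The code is the fixed space of a linear projection \<open>g\<close> onto it, hence the
  kernel of \<open>id + g\<close> over \<open>GF(2)\<close>; this gives a square matrix with
  \<open>n\<close> checks.\<close>

lemma parity_check_matrix:
  assumes "binary_linear_code n \<C>"
  obtains H where "\<C> = {v \<in> GF2_space {1..n}. \<forall>j\<in>{1..n}. (\<Sum>i=1..n. H j i * v i) = 0}"
proof -
  have \<C>: "GF2.subspace \<C>" "\<C> \<subseteq> GF2_space {1..n}"
    using assms by (auto simp: binary_linear_code_def)
  interpret vector_space_pair "scale_bit :: bit \<Rightarrow> (nat \<Rightarrow> bit) \<Rightarrow> nat \<Rightarrow> bit"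
      "scale_bit :: bit \<Rightarrow> (nat \<Rightarrow> bit) \<Rightarrow> nat \<Rightarrow> bit"
    by unfold_locales
  have "Vector_Spaces.linear scale_bit scale_bit (\<lambda>v :: nat \<Rightarrow> bit. v)"
    by (simp add: GF2_linear_iff)
  \<comment> \<open>A left inverse of the inclusion of the code is such a projection.\<close>
  then obtain g where g: "range g \<subseteq> \<C>" "Vector_Spaces.linear scale_bit scale_bit g" "\<forall>v\<in>\<C>. g v = v"
    using linear_exists_left_inverse_on[OF _ \<C>(1), of "\<lambda>v. v"] by auto
  have g_add: "g (x + y) = g x + g y" for x y
    using g(2) GF2_linear_iff by blast
  then have g0: "g 0 = 0"
    by (metis add_cancel_right_right)
  define unit :: "nat \<Rightarrow> nat \<Rightarrow> bit" where "unit i = (\<lambda>k. if k = i then 1 else 0)" for i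
  have g_sum: "g (\<lambda>k. \<Sum>i\<in>I. v i * unit i k) = (\<lambda>k. \<Sum>i\<in>I. v i * g (unit i) k)"
    if "finite I" for I v
    using that
  proof (induction I)
    case empty
    then show ?case
      using g0 by (simp add: zero_fun_def)
  next
    case (insert i I)
    have "g (\<lambda>k. v i * unit i k) = (\<lambda>k. v i * g (unit i) k)"
      using g0 by (cases "v i = 1") (auto simp: zero_fun_def)
    then show ?case
      using insert g_add[of "\<lambda>k. v i * unit i k" "\<lambda>k. \<Sum>i\<in>I. v i * unit i k"]
      by (simp add: plus_fun_def)
  qed
  have expand: "g v k = (\<Sum>i=1..n. v i * g (unit i) k)" if "v \<in> GF2_space {1..n}" for v k
  proof -
    have "v = (\<lambda>k. \<Sum>i=1..n. v i * unit i k)"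
    proof
      fix k
      have "(\<Sum>i=1..n. v i * unit i k) = (\<Sum>i=1..n. if k = i then v i else 0)"
        by (intro sum.cong) (auto simp: unit_def)
      then show "v k = (\<Sum>i=1..n. v i * unit i k)"
        using that by (auto simp: GF2_space_def)
    qed
    then show ?thesis
      using g_sum[of "{1..n}" v] by (metis finite_atLeastAtMost)
  qed
  have fixed: "v \<in> \<C> \<longleftrightarrow> v \<in> GF2_space {1..n} \<and> g v = v" for v
    using g(1,3) \<C>(2) by (metis rangeI subsetD)
  have g_off: "g v k = 0" if "k \<notin> {1..n}" for v k
    using g(1) \<C>(2) that unfolding GF2_space_def by blast
  \<comment> \<open>The matrix of \<open>id + g\<close> in the unit vectors, plus and minus being
    the same mod 2.\<close>
  define H where "H j i = unit i j + g (unit i) j" for j i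
  have sums: "(\<Sum>i=1..n. H j i * v i) = v j + g v j" if "v \<in> GF2_space {1..n}" "j \<in> {1..n}" for v j
  proof -
    have "(\<Sum>i=1..n. H j i * v i) = (\<Sum>i=1..n. unit i j * v i) + (\<Sum>i=1..n. v i * g (unit i) j)"
      by (simp add: H_def algebra_simps sum.distrib)
    also have "(\<Sum>i=1..n. unit i j * v i) = (\<Sum>i=1..n. if j = i then v i else 0)"
      by (intro sum.cong) (auto simp: unit_def)
    finally show ?thesis
      using that expand[of v j] by simp
  qed
  then have "g v = v \<longleftrightarrow> (\<forall>j\<in>{1..n}. (\<Sum>i=1..n. H j i * v i) = 0)" if "v \<in> GF2_space {1..n}" for v
  proof -
    have "g v = v \<longleftrightarrow> (\<forall>j\<in>{1..n}. v j = g v j)"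
    proof
      assume *: "\<forall>j\<in>{1..n}. v j = g v j"
      show "g v = v"
      proof
        fix k
        show "g v k = v k"
          using * that g_off[of k v] by (cases "k \<in> {1..n}") (simp_all add: GF2_space_def)
      qed
    qed simp
    then show ?thesis
      using sums[OF that] by (simp add: bit_add_eq_0_iff)
  qed
  then show thesis
    using fixed that[of H] by blast
qed

section \<open>The restriction isomorphism from the kernel onto the code\<close>

lemma config_isomorphic_refl: "config_isomorphic \<Delta> \<Delta>"
  unfolding config_isomorphic_def by (intro exI[of _ id]) (auto simp: bij_betw_def)

theorem theorem5:
  fixes n :: nat and \<C> :: "(nat \<Rightarrow> bit) set"
  assumes "binary_linear_code n \<C>"
  shows "\<exists>(\<Delta> :: (real^4) set set) S.
           geometric_representation n \<C> \<Delta> S \<and> embeddable_into \<Delta> TYPE(real^4)"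
proof -
  obtain H where \<C>: "\<C> = {v \<in> GF2_space {1..n}. \<forall>j\<in>{1..n}. (\<Sum>i=1..n. H j i * v i) = 0}"
    using parity_check_matrix[OF assms] .
  interpret check_complex n H .
  obtain \<Delta> :: "(real^4) set set" and \<beta> where
    \<Delta>: "triangular_configuration \<Delta>" and \<beta>: "bij_betw \<beta> faces (triangles \<Delta>)" and
    ker: "config_ker \<Delta> = {v \<in> GF2_space (triangles \<Delta>).
       \<forall>e. card e = 2 \<longrightarrow> (\<Sum>t | t \<in> faces \<and> e \<subseteq> t. v (\<beta> t)) = 0}"
    by (rule moment_configuration[OF _ inj_on_pos faces_nonempty faces_vertices faces_consecutive])
      (simp_all add: finite_base)
  have ker_iff: "v \<in> config_ker \<Delta> \<longleftrightarrow> v \<in> GF2_space (triangles \<Delta>) \<and> closed_chain (v \<circ> \<beta>)" for v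
    by (simp add: ker closed_chain_def star_sum_def)
  \<comment> \<open>The first fan triangle represents sheet \<open>i\<close>; it is present
    whichever checks contain \<open>i\<close>.\<close>
  define b where "b i = \<beta> (fan i 1)" for i
  define S where "S = triangles \<Delta> - b ` {1..n}"
  \<comment> \<open>Puncturing followed by relabelling, as one linear map to which
    \<open>GF2_dim_image\<close> applies.\<close>
  define R where "R v = (\<lambda>i. if i \<in> {1..n} then v (b i) else 0)" for v :: "(real^4) set \<Rightarrow> bit"
  have b_tri: "b i \<in> triangles \<Delta>" if "i \<in> {1..n}" for i
    using \<beta> fan_faces[OF that] unfolding b_def by (auto simp: bij_betw_def)
  have "inj_on b {1..n}"
  proof (rule inj_onI)
    fix i k assume "i \<in> {1..n}" "k \<in> {1..n}" "b i = b k"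
    then have "fan i 1 = fan k 1"
      using \<beta> fan_faces unfolding b_def bij_betw_def inj_on_def by blast
    then show "i = k"
      using inj_fan[of 1 UNIV] by (auto dest: injD)
  qed
  moreover have "triangles \<Delta> - S = b ` {1..n}"
    using b_tri by (auto simp: S_def)
  ultimately have bij: "bij_betw b {1..n} (triangles \<Delta> - S)"
    by (simp add: bij_betw_def)
  have lin: "Vector_Spaces.linear scale_bit scale_bit R"
    by (auto simp: GF2_linear_iff R_def fun_eq_iff)
  have sub: "GF2.subspace (config_ker \<Delta>)"
    by (auto simp: GF2_subspace_iff ker GF2_space_def sum.distrib)
  have inj: "inj_on R (config_ker \<Delta>)"
  proof (rule inj_onI)
    fix v v' assume v: "v \<in> config_ker \<Delta>" "v' \<in> config_ker \<Delta>" and eq: "R v = R v'"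
    have "(v \<circ> \<beta>) (fan i 1) = (v' \<circ> \<beta>) (fan i 1)" if "i \<in> {1..n}" for i
      using fun_cong[OF eq, of i] that by (simp add: R_def b_def)
    then have "(v \<circ> \<beta>) t = (v' \<circ> \<beta>) t" if "t \<in> faces" for t
      using closed_chain_determined[OF _ _ _ that] v ker_iff by blast
    then have "\<forall>t\<in>\<beta> ` faces. v t = v' t"
      by simp
    then have "v t = v' t" if "t \<in> triangles \<Delta>" for t
      using that unfolding bij_betw_imp_surj_on[OF \<beta>] by blast
    moreover have "v t = v' t" if "t \<notin> triangles \<Delta>" for t
      using v that by (simp add: ker GF2_space_def)
    ultimately show "v = v'"
      by blast
  qed
  have "R v \<in> \<C>" if v: "v \<in> config_ker \<Delta>" for v
  proof -
    have "(\<Sum>i=1..n. H j i * R v i) = 0" if j: "j \<in> {1..n}" for j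
    proof -
      have "(\<Sum>i=1..n. H j i * R v i) = (\<Sum>i=1..n. H j i * (v \<circ> \<beta>) (fan i 1))"
        by (intro sum.cong) (auto simp: R_def b_def)
      then show ?thesis
        using closed_chain_check[OF _ j, of "v \<circ> \<beta>"] v ker_iff by simp
    qed
    then show ?thesis
      by (auto simp: \<C> GF2_space_def R_def)
  qed
  moreover have "x \<in> R ` config_ker \<Delta>" if x: "x \<in> \<C>" for x
  proof -
    have closed: "closed_chain (spread x)"
      using x by (intro closed_chain_spread) (simp add: \<C>)
    \<comment> \<open>The cycle \<open>spread x\<close> is carried over by \<open>\<beta>\<close>
      and set to zero off the triangles, as membership in \<open>GF2_space\<close> demands.\<close>
    define v where "v s = (if s \<in> triangles \<Delta> then spread x (inv_into faces \<beta> s) else 0)" for s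
    have v: "v (\<beta> t) = spread x t" if "t \<in> faces" for t
      using that \<beta> by (auto simp: v_def bij_betw_def)
    have "closed_chain (v \<circ> \<beta>)"
    proof -
      have "star_sum faces (v \<circ> \<beta>) e = star_sum faces (spread x) e" for e
        unfolding star_sum_def by (intro sum.cong) (auto simp: v)
      then show ?thesis
        using closed by (simp add: closed_chain_def)
    qed
    then have "v \<in> config_ker \<Delta>"
      unfolding ker_iff by (simp add: v_def GF2_space_def)
    moreover have "R v = x"
    proof
      fix i
      show "R v i = x i"
      proof (cases "i \<in> {1..n}")
        case True
        then have "1 \<in> {1..n}"
          by simp
        then have "spread x (fan i 1) = x i"
          using constant_on_sheets_spread[of x] True by (auto simp: constant_on_sheets_def)
        then show ?thesis
          using True v[OF fan_faces[OF True]] by (simp add: R_def b_def)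
      next
        case False
        then show ?thesis
          using x unfolding R_def \<C> GF2_space_def by auto
      qed
    qed
    ultimately show ?thesis
      by blast
  qed
  ultimately have image: "\<C> = R ` config_ker \<Delta>"
    by blast
  have "relabel {1..n} b (puncture (config_ker \<Delta>) S) = R ` config_ker \<Delta>"
    unfolding relabel_def puncture_def image_image R_def
    by (intro image_cong) (auto simp: S_def fun_eq_iff)
  then have "geometric_representation n \<C> \<Delta> S"
    unfolding geometric_representation_def
    using \<Delta> bij image GF2_dim_image[OF lin sub inj] by (auto simp: S_def)
  \<comment> \<open>The configuration was built in \<open>real^4\<close>, so it is its own embedded
    copy.\<close>
  moreover have "embeddable_into \<Delta> TYPE(real^4)"
    unfolding embeddable_into_def using \<Delta> config_isomorphic_refl by blast
  ultimately show ?thesis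
    by blast
qed

end
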